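(* For every integer $n\geqslant 0$ the following hold. (i) $(-1)^n\, Q_0(n) = pod_{e}(n)-pod_{o}(n)$. (ii) $(-1)^n\, Q_2(n) = b_{4,e}(n)-b_{4,o}(n)$.
   Context: A partition of $n$ is a nonincreasing sequence of positive integers (called parts) with sum $n$; the empty partition is the only partition of $0$ (it has $0$ parts, an even number). For $k\in\{0,2\}$, $Q_k(n)$ is the number of partitions of $n$ into distinct parts none of which is congruent to $k$ modulo $4$. $pod_e(n)$ (respectively $pod_o(n)$) is the number of partitions of $n$ into an even (respectively odd) number of parts, none of which is congruent to $2$ modulo $4$ (repeated parts allowed). A partition is $4$-regular if none of its parts is divisible by $4$. $b_{4,e}(n)$ (respectively $b_{4,o}(n)$) is the number of $4$-regular partitions of $n$ into an even (respectively odd) number of parts. *)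

theory Defs
  imports Complex_Main "HOL-Number_Theory.Cong"
begin

definition partitions :: "nat \<Rightarrow> nat list set" where
  "partitions n = {xs. sorted_wrt (\<ge>) xs \<and> (\<forall>p\<in>set xs. p > 0) \<and> sum_list xs = n}"

(* Ensures that the cardinalities below are genuine counts
   (card is 0 on infinite sets). *)
lemma finite_partitions: "finite (partitions n)"
proof (rule finite_subset)
  have len: "length xs \<le> sum_list xs" if "\<forall>p\<in>set xs. p > 0" for xs :: "nat list"
    using that by (induction xs) auto
  show "partitions n \<subseteq> {xs. set xs \<subseteq> {..n} \<and> length xs \<le> n}"
    using len by (auto simp: partitions_def member_le_sum_list)
  show "finite {xs. set xs \<subseteq> {..n} \<and> length xs \<le> n}"
    by (rule finite_lists_length_le) simp
qed

(* The parameter k is used for k = 0 and k = 2. *)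
definition Q :: "nat \<Rightarrow> nat \<Rightarrow> nat" where
  "Q k n = card {xs \<in> partitions n. distinct xs \<and> (\<forall>p\<in>set xs. \<not> [p = k] (mod 4))}"

definition pod_e :: "nat \<Rightarrow> nat" where
  "pod_e n = card {xs \<in> partitions n. (\<forall>p\<in>set xs. \<not> [p = 2] (mod 4)) \<and> even (length xs)}"

definition pod_o :: "nat \<Rightarrow> nat" where
  "pod_o n = card {xs \<in> partitions n. (\<forall>p\<in>set xs. \<not> [p = 2] (mod 4)) \<and> odd (length xs)}"

definition regular_partition :: "nat \<Rightarrow> nat list \<Rightarrow> bool" where
  "regular_partition l xs \<longleftrightarrow> (\<forall>p\<in>set xs. \<not> l dvd p)"

definition b4_e :: "nat \<Rightarrow> nat" where
  "b4_e n = card {xs \<in> partitions n. regular_partition 4 xs \<and> even (length xs)}"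

definition b4_o :: "nat \<Rightarrow> nat" where
  "b4_o n = card {xs \<in> partitions n. regular_partition 4 xs \<and> odd (length xs)}"

end

theory Submission
  imports Defs "HOL-Computational_Algebra.Formal_Power_Series"
begin

text \<open>Both identities are instances of one statement, \<open>distinct_partitions_signed_count\<close>. Let
  \<open>S\<close> be any set of even numbers, and write products over positive \<open>m\<close>. Counting partitions of
  \<open>n\<close> into distinct parts that are odd or in \<open>S\<close>, with sign \<open>(-1) ^ n\<close>, gives the series
  \<open>\<Prod>\<^bsub>m odd or in S\<^esub> (1 + (-X)^m) = \<Prod>\<^bsub>m odd\<^esub> (1 - X^m) * \<Prod>\<^bsub>m \<in> S\<^esub> (1 + X^m)\<close>,
  whereas counting partitions into parts outside \<open>S\<close>, with sign given by the parity of the number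
  of parts, gives \<open>1 / \<Prod>\<^bsub>m \<notin> S\<^esub> (1 + X^m)\<close>. The two agree because of Euler's identity
  \<open>\<Prod>\<^bsub>m odd\<^esub> (1 - X^m) * \<Prod>\<^bsub>m\<^esub> (1 + X^m) = 1\<close>.
  The choices \<open>S = {m. m \<equiv> 2 (mod 4)}\<close> and \<open>S = {m. m \<equiv> 0 (mod 4)}\<close> give (i) and (ii).

  Infinite products are avoided by admitting only parts up to a bound \<open>N \<ge> n\<close>. The generating
  functions are then finite products (\<open>distinct_gf_prod\<close>, \<open>signed_gf_prod\<close>), and Euler's identity
  holds up to a factor \<open>\<Prod>\<^bsub>N < 2m \<le> 2N\<^esub> (1 - X^(2m))\<close> (\<open>euler_truncated\<close>), which does not
  affect the coefficients of \<open>X^n\<close> for \<open>n \<le> N\<close>.\<close>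

unbundle fps_syntax

section \<open>Generating functions of partitions with parts in a finite set\<close>

definition signed_gf :: "nat set \<Rightarrow> int fps" where
  "signed_gf A = Abs_fps (\<lambda>n. \<Sum>xs\<in>{xs \<in> partitions n. set xs \<subseteq> A}. (-1) ^ length xs)"

text \<open>The factor \<open>(-1) ^ n\<close> substitutes \<open>-X\<close> for \<open>X\<close>: odd parts contribute \<open>1 - X^m\<close>, even parts
  \<open>1 + X^m\<close>.\<close>

definition distinct_gf :: "nat set \<Rightarrow> int fps" where
  "distinct_gf A =
    Abs_fps (\<lambda>n. (-1) ^ n * int (card {xs \<in> partitions n. distinct xs \<and> set xs \<subseteq> A}))"

lemma Cons_in_partitions_iff:
  "m # xs \<in> partitions n \<longleftrightarrow>
     0 < m \<and> m \<le> n \<and> (\<forall>p\<in>set xs. p \<le> m) \<and> xs \<in> partitions (n - m)"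
  by (auto simp: partitions_def)

lemma partitions_empty_parts:
  "{xs \<in> partitions n. set xs \<subseteq> {}} = (if n = 0 then {[]} else {})"
  by (auto simp: partitions_def)

text \<open>A new largest part can only occur at the front of the list, so a partition using it is a
  smaller partition with that part prepended.\<close>

lemma partitions_insert_largest:
  assumes "0 < m" and less: "\<forall>a\<in>A. a < m"
  shows "{xs \<in> partitions n. set xs \<subseteq> insert m A} =
    {xs \<in> partitions n. set xs \<subseteq> A} \<union>
    (if m \<le> n then (#) m ` {xs \<in> partitions (n - m). set xs \<subseteq> insert m A} else {})"
    (is "?L = ?R")
proof -
  have le: "\<forall>p\<in>set xs. p \<le> m" if "set xs \<subseteq> insert m A" for xs
    using that less by (auto dest: less_imp_le)
  have "xs \<in> ?L \<longleftrightarrow> xs \<in> ?R" for xs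
  proof (cases xs)
    case Nil
    then show ?thesis by auto
  next
    case (Cons y ys)
    show ?thesis
    proof (cases "y = m")
      case True
      have "m \<notin> A"
        using less by blast
      then show ?thesis
        using le[of ys] \<open>0 < m\<close> by (simp add: Cons True Cons_in_partitions_iff image_iff) blast
    next
      case False
      have "set xs \<subseteq> A" if "xs \<in> ?L"
      proof -
        from that False have "y \<in> A" and "\<forall>p\<in>set ys. p \<le> y" and "set ys \<subseteq> insert m A"
          by (auto simp: Cons Cons_in_partitions_iff)
        with less have "y \<in> A" and "m \<notin> set ys" and "set ys \<subseteq> insert m A"
          by (auto simp: not_le[symmetric])
        then show ?thesis
          by (auto simp: Cons)
      qed
      moreover have "xs \<notin> (#) m ` B" for B
        using False by (auto simp: Cons)
      ultimately show ?thesis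
        by auto
    qed
  qed
  then show ?thesis
    by blast
qed

lemma distinct_partitions_insert_largest:
  assumes "0 < m" and less: "\<forall>a\<in>A. a < m"
  shows "{xs \<in> partitions n. distinct xs \<and> set xs \<subseteq> insert m A} =
    {xs \<in> partitions n. distinct xs \<and> set xs \<subseteq> A} \<union>
    (if m \<le> n then (#) m ` {xs \<in> partitions (n - m). distinct xs \<and> set xs \<subseteq> A} else {})"
proof -
  have "{xs \<in> partitions n. distinct xs \<and> set xs \<subseteq> insert m A} =
      {xs \<in> {xs \<in> partitions n. set xs \<subseteq> insert m A}. distinct xs}"
    by blast
  also have "\<dots> = {xs \<in> partitions n. distinct xs \<and> set xs \<subseteq> A} \<union>
      (if m \<le> n
       then {xs \<in> (#) m ` {xs \<in> partitions (n - m). set xs \<subseteq> insert m A}. distinct xs} else {})"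
    unfolding partitions_insert_largest[OF assms, of n] by auto
  also have "{xs \<in> (#) m ` {xs \<in> partitions (n - m). set xs \<subseteq> insert m A}. distinct xs} =
      (#) m ` {xs \<in> partitions (n - m). distinct xs \<and> set xs \<subseteq> A}"
    using less by (auto simp: image_iff)
  finally show ?thesis .
qed

text \<open>Prepending \<open>m\<close> changes the parity of the number of parts, so the partitions that use \<open>m\<close>
  contribute \<open>- X^m\<close> times the whole series.\<close>

lemma signed_gf_insert_largest:
  assumes "0 < m" and "\<forall>a\<in>A. a < m"
  shows "(1 + fps_X ^ m) * signed_gf (insert m A) = signed_gf A"
proof (rule fps_ext)
  fix n
  let ?B = "{xs \<in> partitions n. set xs \<subseteq> A}"
  let ?C = "{xs \<in> partitions (n - m). set xs \<subseteq> insert m A}"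
  have "signed_gf (insert m A) $ n =
    signed_gf A $ n - (if m \<le> n then signed_gf (insert m A) $ (n - m) else 0)"
  proof (cases "m \<le> n")
    case True
    have "?B \<inter> (#) m ` ?C = {}"
      using assms(2) by fastforce
    then have "signed_gf (insert m A) $ n =
        (\<Sum>xs\<in>?B. (-1) ^ length xs) + (\<Sum>xs\<in>(#) m ` ?C. (-1) ^ length xs)"
      using True
      by (simp add: signed_gf_def partitions_insert_largest[OF assms, of n] sum.union_disjoint
          finite_partitions)
    also have "(\<Sum>xs\<in>(#) m ` ?C. (-1) ^ length xs) = - (\<Sum>xs\<in>?C. (-1) ^ length xs :: int)"
      by (simp add: sum.reindex sum_negf)
    finally show ?thesis
      using True by (simp add: signed_gf_def)
  next
    case False
    then show ?thesis
      by (simp add: signed_gf_def partitions_insert_largest[OF assms, of n])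
  qed
  then show "((1 + fps_X ^ m) * signed_gf (insert m A)) $ n = signed_gf A $ n"
    by (simp add: distrib_right fps_X_power_mult_nth)
qed

lemma distinct_gf_insert_largest:
  assumes "0 < m" and "\<forall>a\<in>A. a < m"
  shows "distinct_gf (insert m A) = (1 + (- fps_X) ^ m) * distinct_gf A"
proof (rule fps_ext)
  fix n
  let ?B = "{xs \<in> partitions n. distinct xs \<and> set xs \<subseteq> A}"
  let ?C = "{xs \<in> partitions (n - m). distinct xs \<and> set xs \<subseteq> A}"
  have rhs: "((1 + (- fps_X) ^ m) * distinct_gf A) $ n =
    distinct_gf A $ n + (if m \<le> n then (-1) ^ m * distinct_gf A $ (n - m) else 0)"
  proof -
    have "(- fps_X :: int fps) ^ m = fps_const ((-1) ^ m) * fps_X ^ m"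
      by (metis fps_const_neg fps_const_power fps_const_1_eq_1 mult_minus1 power_mult_distrib)
    then show ?thesis
      by (simp add: distrib_right mult.assoc fps_X_power_mult_nth)
  qed
  show "distinct_gf (insert m A) $ n = ((1 + (- fps_X) ^ m) * distinct_gf A) $ n"
  proof (cases "m \<le> n")
    case True
    have "?B \<inter> (#) m ` ?C = {}"
      using assms(2) by fastforce
    then have "card {xs \<in> partitions n. distinct xs \<and> set xs \<subseteq> insert m A} = card ?B + card ?C"
      using True
      by (simp add: distinct_partitions_insert_largest[OF assms, of n] card_Un_disjoint
          finite_partitions card_image)
    moreover have "(-1 :: int) ^ n = (-1) ^ m * (-1) ^ (n - m)"
      using True by (simp flip: power_add)
    ultimately show ?thesis
      using True unfolding rhs by (simp add: distinct_gf_def algebra_simps)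
  next
    case False
    then show ?thesis
      unfolding rhs by (simp add: distinct_gf_def distinct_partitions_insert_largest[OF assms, of n])
  qed
qed

lemma signed_gf_prod:
  assumes "finite A" and "0 \<notin> A"
  shows "(\<Prod>m\<in>A. 1 + fps_X ^ m) * signed_gf A = 1"
  using assms
proof (induction A rule: finite_linorder_max_induct)
  case empty
  show ?case
    by (rule fps_ext) (simp add: signed_gf_def partitions_empty_parts[simplified])
next
  case (insert m A)
  then have "(1 + fps_X ^ m) * signed_gf (insert m A) = signed_gf A"
    by (intro signed_gf_insert_largest) auto
  moreover have "m \<notin> A"
    using insert.hyps by blast
  ultimately have "(\<Prod>k\<in>insert m A. 1 + fps_X ^ k) * signed_gf (insert m A) =
      (\<Prod>k\<in>A. 1 + fps_X ^ k) * signed_gf A"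
    using insert.hyps(1) by (simp add: mult_ac)
  then show ?case
    using insert by simp
qed

lemma distinct_gf_prod:
  assumes "finite A" and "0 \<notin> A"
  shows "distinct_gf A = (\<Prod>m\<in>A. 1 + (- fps_X) ^ m)"
  using assms
proof (induction A rule: finite_linorder_max_induct)
  case empty
  have "{xs \<in> partitions n. distinct xs \<and> xs = []} = (if n = 0 then {[]} else {})" for n
    by (auto simp: partitions_def)
  then show ?case
    by (intro fps_ext) (simp add: distinct_gf_def)
next
  case (insert m A)
  then have "distinct_gf (insert m A) = (1 + (- fps_X) ^ m) * distinct_gf A"
    by (intro distinct_gf_insert_largest) auto
  moreover have "m \<notin> A"
    using insert.hyps by blast
  ultimately show ?case
    using insert by simp
qed

section \<open>Euler's identity modulo a power of X\<close>

text \<open>Multiplying \<open>\<Prod> (1 + X^m)\<close> by \<open>\<Prod> (1 - X^m)\<close> gives \<open>\<Prod> (1 - X^(2m))\<close>; its factors with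
  \<open>2 * m \<le> N\<close> are the even-indexed factors of \<open>\<Prod> (1 - X^m)\<close> and cancel.\<close>

lemma euler_truncated:
  fixes N :: nat
  shows "(\<Prod>m\<in>{m\<in>{1..N}. odd m}. 1 - fps_X ^ m) * (\<Prod>m\<in>{1..N}. 1 + fps_X ^ m) =
    (\<Prod>m\<in>{m\<in>{N<..2*N}. even m}. 1 - fps_X ^ m :: int fps)"
proof -
  let ?f = "\<lambda>m. 1 - fps_X ^ m :: int fps"
  let ?odd = "\<Prod>m\<in>{m\<in>{1..N}. odd m}. ?f m"
  let ?even = "\<Prod>m\<in>{m\<in>{1..N}. even m}. ?f m"
  let ?tail = "\<Prod>m\<in>{m\<in>{N<..2*N}. even m}. ?f m"
  let ?plus = "\<Prod>m\<in>{1..N}. 1 + fps_X ^ m :: int fps"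
  have "{1..N} = {m\<in>{1..N}. odd m} \<union> {m\<in>{1..N}. even m}"
    by auto
  then have all: "(\<Prod>m\<in>{1..N}. ?f m) = ?odd * ?even"
    by (subst \<open>{1..N} = _\<close>, intro prod.union_disjoint) auto
  have "(\<Prod>m\<in>{1..N}. ?f m) * ?plus = (\<Prod>m\<in>{1..N}. ?f (2 * m))"
    unfolding prod.distrib[symmetric]
    by (intro prod.cong refl) (simp add: mult_2_right power_add algebra_simps)
  also have "\<dots> = (\<Prod>m\<in>(*) 2 ` {1..N}. ?f m)"
    by (subst prod.reindex) (auto simp: inj_on_def)
  also have "(*) 2 ` {1..N} = {m\<in>{1..N}. even m} \<union> {m\<in>{N<..2*N}. even m}"
    by (auto elim!: evenE)
  also have "prod ?f \<dots> = ?even * ?tail"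
    by (intro prod.union_disjoint) auto
  finally have cancel: "?even * (?odd * ?plus) = ?even * ?tail"
    by (simp only: all mult_ac)
  have "?even \<noteq> 0"
  proof -
    have "?f m \<noteq> 0" if "1 \<le> m" for m
    proof
      assume "?f m = 0"
      then have "?f m $ 0 = 0" by simp
      then show False using that by simp
    qed
    then show ?thesis by (auto simp: prod_zero_iff)
  qed
  from this cancel show ?thesis
    by (rule mult_left_cancel[THEN iffD1])
qed

lemma prod_one_minus_X_power_cong_1:
  assumes "finite A" and "\<And>m. m \<in> A \<Longrightarrow> N < m"
  shows "fps_X ^ Suc N dvd (\<Prod>m\<in>A. 1 - fps_X ^ m) - (1 :: int fps)"
  using assms
proof (induction A rule: finite_induct)
  case empty
  show ?case by simp
next
  case (insert m A)
  let ?P = "\<Prod>m\<in>A. 1 - fps_X ^ m :: int fps"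
  have "(\<Prod>m\<in>insert m A. 1 - fps_X ^ m) - 1 = (?P - 1) - fps_X ^ m * ?P"
    using insert.hyps by (simp add: algebra_simps)
  moreover have "fps_X ^ Suc N dvd (fps_X ^ m * ?P)"
    using insert.prems by (intro dvd_mult2 le_imp_power_dvd) (simp add: Suc_le_eq)
  ultimately show ?case
    using insert by (simp only: dvd_diff) simp
qed

section \<open>Comparison of the two signed counts\<close>

lemma distinct_gf_eq_signed_gf:
  fixes N n :: nat
  assumes S: "\<And>m. m \<in> S \<Longrightarrow> even m" and "n \<le> N"
  shows "distinct_gf {m\<in>{1..N}. odd m \<or> m \<in> S} $ n = signed_gf {m\<in>{1..N}. m \<notin> S} $ n"
proof -
  let ?A = "{m\<in>{1..N}. odd m \<or> m \<in> S}" and ?B = "{m\<in>{1..N}. m \<notin> S}"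
  let ?g = "\<lambda>m. 1 + fps_X ^ m :: int fps"
  let ?R = "\<Prod>m\<in>{m\<in>{N<..2*N}. even m}. 1 - fps_X ^ m :: int fps"
  have "distinct_gf ?A = (\<Prod>m\<in>?A. 1 + (- fps_X) ^ m)"
    by (rule distinct_gf_prod) auto
  also have "\<dots> = (\<Prod>m\<in>{m\<in>{1..N}. odd m} \<union> {m\<in>{1..N}. m \<in> S}. 1 + (- fps_X) ^ m)"
    by (intro prod.cong) auto
  also have "\<dots> = (\<Prod>m\<in>{m\<in>{1..N}. odd m}. 1 + (- fps_X) ^ m) *
      (\<Prod>m\<in>{m\<in>{1..N}. m \<in> S}. 1 + (- fps_X) ^ m :: int fps)"
    using S by (intro prod.union_disjoint) auto
  also have "\<dots> = (\<Prod>m\<in>{m\<in>{1..N}. odd m}. 1 - fps_X ^ m) * (\<Prod>m\<in>{m\<in>{1..N}. m \<in> S}. ?g m)"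
    using S by (intro arg_cong2[where f = "(*)"] prod.cong) auto
  finally have distinct: "distinct_gf ?A =
    (\<Prod>m\<in>{m\<in>{1..N}. odd m}. 1 - fps_X ^ m) * (\<Prod>m\<in>{m\<in>{1..N}. m \<in> S}. ?g m)" .
  have "(\<Prod>m\<in>{m\<in>{1..N}. m \<in> S}. ?g m) * (\<Prod>m\<in>?B. ?g m) =
      (\<Prod>m\<in>{m\<in>{1..N}. m \<in> S} \<union> ?B. ?g m)"
    by (intro prod.union_disjoint[symmetric]) auto
  also have "{m\<in>{1..N}. m \<in> S} \<union> ?B = {1..N}"
    by auto
  finally have prod_R: "distinct_gf ?A * (\<Prod>m\<in>?B. ?g m) = ?R"
    by (simp only: distinct mult.assoc euler_truncated)
  have prod_1: "(\<Prod>m\<in>?B. ?g m) * signed_gf ?B = 1"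
    by (rule signed_gf_prod) auto
  have "fps_X ^ Suc N dvd ?R - 1"
    by (rule prod_one_minus_X_power_cong_1) auto
  then obtain U where U: "?R - 1 = fps_X ^ Suc N * U" ..
  have "distinct_gf ?A = distinct_gf ?A * ((\<Prod>m\<in>?B. ?g m) * signed_gf ?B)"
    unfolding prod_1 by simp
  also have "\<dots> = ?R * signed_gf ?B"
    unfolding prod_R[symmetric] by (simp only: mult.assoc)
  also have "\<dots> = signed_gf ?B + (?R - 1) * signed_gf ?B"
    by (simp only: left_diff_distrib) simp
  also have "\<dots> = signed_gf ?B + fps_X ^ Suc N * (U * signed_gf ?B)"
    unfolding U by (simp only: mult.assoc)
  finally have "distinct_gf ?A = signed_gf ?B + fps_X ^ Suc N * (U * signed_gf ?B)" .
  then show ?thesis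
    using \<open>n \<le> N\<close> by (simp only: fps_add_nth fps_X_power_mult_nth) simp
qed

text \<open>For the coefficient of \<open>X^n\<close> the bound \<open>N = n\<close> is no restriction, as no part of a
  partition of \<open>n\<close> exceeds \<open>n\<close>.\<close>

lemma distinct_partitions_signed_count:
  assumes S: "\<And>m. m \<in> S \<Longrightarrow> even m"
  shows "(-1) ^ n * int (card {xs \<in> partitions n. distinct xs \<and> (\<forall>p\<in>set xs. odd p \<or> p \<in> S)}) =
    int (card {xs \<in> partitions n. (\<forall>p\<in>set xs. p \<notin> S) \<and> even (length xs)}) -
    int (card {xs \<in> partitions n. (\<forall>p\<in>set xs. p \<notin> S) \<and> odd (length xs)})"
proof -
  have bound: "set xs \<subseteq> {1..n}" if "xs \<in> partitions n" for xs
    using that by (auto simp: partitions_def Suc_le_eq intro: member_le_sum_list)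
  let ?E = "{xs \<in> partitions n. (\<forall>p\<in>set xs. p \<notin> S) \<and> even (length xs)}"
  let ?O = "{xs \<in> partitions n. (\<forall>p\<in>set xs. p \<notin> S) \<and> odd (length xs)}"
  have "{xs \<in> partitions n. distinct xs \<and> (\<forall>p\<in>set xs. odd p \<or> p \<in> S)} =
      {xs \<in> partitions n. distinct xs \<and> set xs \<subseteq> {m\<in>{1..n}. odd m \<or> m \<in> S}}"
    using bound by blast
  then have "(-1) ^ n *
      int (card {xs \<in> partitions n. distinct xs \<and> (\<forall>p\<in>set xs. odd p \<or> p \<in> S)}) =
      distinct_gf {m\<in>{1..n}. odd m \<or> m \<in> S} $ n"
    by (simp add: distinct_gf_def)
  also have "\<dots> = signed_gf {m\<in>{1..n}. m \<notin> S} $ n"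
    using S by (intro distinct_gf_eq_signed_gf) auto
  also have "\<dots> = (\<Sum>xs\<in>{xs \<in> partitions n. set xs \<subseteq> {m\<in>{1..n}. m \<notin> S}}. (-1) ^ length xs)"
    by (simp add: signed_gf_def)
  also have "{xs \<in> partitions n. set xs \<subseteq> {m\<in>{1..n}. m \<notin> S}} = ?E \<union> ?O"
    using bound by blast
  also have "(\<Sum>xs\<in>?E \<union> ?O. (-1) ^ length xs) =
      (\<Sum>xs\<in>?E. (-1) ^ length xs) + (\<Sum>xs\<in>?O. (-1) ^ length xs :: int)"
    by (intro sum.union_disjoint) (auto simp: finite_partitions)
  also have "\<dots> = int (card ?E) - int (card ?O)"
    by simp
  finally show ?thesis .
qed

theorem theorem1p1:
  fixes n :: nat
  shows "(-1) ^ n * int (Q 0 n) = int (pod_e n) - int (pod_o n) \<and>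
         (-1) ^ n * int (Q 2 n) = int (b4_e n) - int (b4_o n)"
proof
  have "\<not> [p = 0] (mod 4) \<longleftrightarrow> odd p \<or> p \<in> {p. [p = 2] (mod 4)}" for p :: nat
    unfolding cong_def mem_Collect_eq by presburger
  moreover have "even p" if "p \<in> {p. [p = 2] (mod 4)}" for p :: nat
    using that unfolding cong_def mem_Collect_eq by presburger
  ultimately show "(-1) ^ n * int (Q 0 n) = int (pod_e n) - int (pod_o n)"
    using distinct_partitions_signed_count[of "{p. [p = 2] (mod 4)}" n]
    by (simp add: Q_def pod_e_def pod_o_def)
next
  have "\<not> [p = 2] (mod 4) \<longleftrightarrow> odd p \<or> p \<in> {p. 4 dvd p}" for p :: nat
    unfolding cong_def mem_Collect_eq by presburger
  moreover have "even p" if "p \<in> {p. 4 dvd p}" for p :: nat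
    using that unfolding mem_Collect_eq by presburger
  ultimately show "(-1) ^ n * int (Q 2 n) = int (b4_e n) - int (b4_o n)"
    using distinct_partitions_signed_count[of "{p. 4 dvd p}" n]
    by (simp add: Q_def b4_e_def b4_o_def regular_partition_def)
qed

end
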